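(* Let $\alpha=\{\alpha_k\}_{k\in\mathbb{Z}}\subset\mathbb{D}$ be a reflectionless sequence of Verblunsky coefficients. Let $U$ be the associated unitary CMV operator on $\ell^2(\mathbb{Z})$ and suppose that $$\sigma(U)=\partial\mathbb{D}.$$ Then $\alpha_k=0$ for all $k\in\mathbb{Z}$.
   Context: Notation. $\mathbb{D}=\{z\in\mathbb{C}: |z|<1\}$, $\partial\mathbb{D}$ is the unit circle, $\mu_0$ is normalized Lebesgue measure on $\partial\mathbb{D}$ ($d\mu_0=d\theta/(2\pi)$). The scalar product on $\ell^2$ is linear in the second argument and $\{\delta_k\}$ is the standard basis. $\sigma(\cdot)$ and $\sigma_{\rm ess}(\cdot)$ denote spectrum and essential spectrum. CMV operator. For $\alpha=\{\alpha_k\}_{k\in\mathbb{Z}}\subset\mathbb{D}$ (the Verblunsky coefficients) put $\rho_k=\sqrt{1-|\alpha_k|^2}$ and $$\theta_k=\begin{pmatrix}-\alpha_k&\rho_k\\ \rho_k&\overline{\alpha_k}\end{pmatrix},\quad k\in\mathbb{Z}.$$ Let $V$ be the block-diagonal unitary operator on $\ell^2(\mathbb{Z})$ whose block on the indices $\{2k-1,2k\}$ is $\theta_{2k}$, and $W$ the block-diagonal unitary operator whose block on the indices $\{2k,2k+1\}$ is $\theta_{2k+1}$, $k\in\mathbb{Z}$. The CMV operator is the unitary operator $U=VW$ on $\ell^2(\mathbb{Z})$. Half-lattice operators. If for some $k_0$ the entry $\alpha_{k_0}$ is replaced by $1$ (so $\rho_{k_0}$ is replaced by $0$), all other entries being kept,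 then the resulting operator $VW$ splits as a direct sum $U_{-,k_0-1}\oplus U_{+,k_0}$ on $\ell^2((-\infty,k_0-1]\cap\mathbb{Z})\oplus\ell^2([k_0,\infty)\cap\mathbb{Z})$. This defines $U_{\pm,k_0}$ for all $k_0\in\mathbb{Z}$ ($U_{-,k_0}$ arises by replacing $\alpha_{k_0+1}$ by $1$). Weyl–Titchmarsh functions. For $z\in\mathbb{C}\setminus\partial\mathbb{D}$, $k\in\mathbb{Z}$, let $$m_\pm(z,k)=\pm\big(\delta_k,(U_{\pm,k}+zI)(U_{\pm,k}-zI)^{-1}\delta_k\big),$$ and, with $a_k=1+\alpha_k$, $b_k=1-\alpha_k$, $$M_+(z,k)=m_+(z,k),\qquad M_-(z,k)=\frac{\operatorname{Re}(a_k)+i\operatorname{Im}(b_k)\,m_-(z,k-1)}{i\operatorname{Im}(a_k)+\operatorname{Re}(b_k)\,m_-(z,k-1)}.$$ On $\mathbb{D}$, $M_+(\cdot,k)$ and $-M_-(\cdot,k)$ are analytic with positive real part, so the radial limits $M_\pm(\zeta,k)=\lim_{r\uparrow1}M_\pm(r\zeta,k)$ exist for $\mu_0$-a.e. $\zeta\in\partial\mathbb{D}$. Reflectionless. $\alpha$ (resp. $U$) is called reflectionless if for all $k\in\mathbb{Z}$, $M_+(\zeta,k)=-\overline{M_-(\zeta,k)}$ for $\mu_0$-a.e. $\zeta\in\sigma_{\rm ess}(U)$. *)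

theory Defs
  imports "HOL-Analysis.Analysis"
begin

section \<open>Operators on spaces of square-summable sequences\<close>

text \<open>For \<open>K\<close> a set of integers, \<open>\<ell>\<^sup>2(K)\<close> is realised as the subspace of \<open>\<ell>\<^sup>2(\<int>)\<close> of
  sequences vanishing off \<open>K\<close>. An operator on it is a function on all sequences, of which only
  the values on this subspace matter.\<close>

definition ell2 :: "int set \<Rightarrow> (int \<Rightarrow> complex) set" where
  "ell2 K = {x. (\<forall>j. j \<notin> K \<longrightarrow> x j = 0) \<and> (\<lambda>j. (cmod (x j))\<^sup>2) summable_on UNIV}"

definition ell2_inner :: "(int \<Rightarrow> complex) \<Rightarrow> (int \<Rightarrow> complex) \<Rightarrow> complex" where
  "ell2_inner x y = (\<Sum>\<^sub>\<infinity>j. cnj (x j) * y j)"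

definition ell2_norm :: "(int \<Rightarrow> complex) \<Rightarrow> real" where
  "ell2_norm x = sqrt (\<Sum>\<^sub>\<infinity>j. (cmod (x j))\<^sup>2)"

definition ell2_delta :: "int \<Rightarrow> int \<Rightarrow> complex" where
  "ell2_delta k = (\<lambda>j. if j = k then 1 else 0)"

definition resolvent ::
  "(int \<Rightarrow> complex) set \<Rightarrow> ((int \<Rightarrow> complex) \<Rightarrow> (int \<Rightarrow> complex)) \<Rightarrow> complex \<Rightarrow>
    (int \<Rightarrow> complex) \<Rightarrow> (int \<Rightarrow> complex)" where
  "resolvent H T z = inv_into H (\<lambda>x j. T x j - z * x j)"

definition resolvent_set ::
  "(int \<Rightarrow> complex) set \<Rightarrow> ((int \<Rightarrow> complex) \<Rightarrow> (int \<Rightarrow> complex)) \<Rightarrow> complex set" where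
  "resolvent_set H T = {z. bij_betw (\<lambda>x j. T x j - z * x j) H H \<and>
     (\<exists>C. \<forall>y\<in>H. ell2_norm (resolvent H T z y) \<le> C * ell2_norm y)}"

definition spectrum ::
  "(int \<Rightarrow> complex) set \<Rightarrow> ((int \<Rightarrow> complex) \<Rightarrow> (int \<Rightarrow> complex)) \<Rightarrow> complex set" where
  "spectrum H T = - resolvent_set H T"

definition eigenspace ::
  "(int \<Rightarrow> complex) set \<Rightarrow> ((int \<Rightarrow> complex) \<Rightarrow> (int \<Rightarrow> complex)) \<Rightarrow> complex \<Rightarrow>
    (int \<Rightarrow> complex) set" where
  "eigenspace H T z = {x \<in> H. T x = (\<lambda>j. z * x j)}"

text \<open>The discrete spectrum of a normal operator consists of the isolated points of the spectrum
  that are eigenvalues of finite multiplicity, and the essential spectrum is the rest of the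
  spectrum. (For normal operators geometric and algebraic multiplicities coincide; the definitions
  are used only for the unitary operator \<open>U\<close>.)\<close>

definition discrete_spectrum ::
  "(int \<Rightarrow> complex) set \<Rightarrow> ((int \<Rightarrow> complex) \<Rightarrow> (int \<Rightarrow> complex)) \<Rightarrow> complex set" where
  "discrete_spectrum H T = {z. z isolated_in spectrum H T \<and>
     (\<exists>x\<in>eigenspace H T z. x \<noteq> (\<lambda>j. 0)) \<and>
     (\<exists>B. finite B \<and> (\<forall>x\<in>eigenspace H T z. \<exists>c. x = (\<lambda>j. \<Sum>b\<in>B. c b * b j)))}"

definition essential_spectrum ::
  "(int \<Rightarrow> complex) set \<Rightarrow> ((int \<Rightarrow> complex) \<Rightarrow> (int \<Rightarrow> complex)) \<Rightarrow> complex set" where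
  "essential_spectrum H T = spectrum H T - discrete_spectrum H T"

section \<open>CMV operators\<close>

definition rho :: "(int \<Rightarrow> complex) \<Rightarrow> int \<Rightarrow> real" where
  "rho \<alpha> k = sqrt (1 - (cmod (\<alpha> k))\<^sup>2)"

definition theta :: "(int \<Rightarrow> complex) \<Rightarrow> int \<Rightarrow> complex^2^2" where
  "theta \<alpha> k = vector [vector [- \<alpha> k, complex_of_real (rho \<alpha> k)],
                      vector [complex_of_real (rho \<alpha> k), cnj (\<alpha> k)]]"

text \<open>Both \<open>V\<close> and \<open>W\<close> have blocks \<open>\<theta>\<^sub>n\<close> on the indices \<open>{n - 1, n}\<close>, for \<open>n\<close> even and
  for \<open>n\<close> odd respectively.\<close>

definition cmv_V :: "(int \<Rightarrow> complex) \<Rightarrow> (int \<Rightarrow> complex) \<Rightarrow> (int \<Rightarrow> complex)" where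
  "cmv_V \<alpha> x = (\<lambda>j. if even j then (theta \<alpha> j *v vector [x (j - 1), x j]) $ 2
                             else (theta \<alpha> (j + 1) *v vector [x j, x (j + 1)]) $ 1)"

definition cmv_W :: "(int \<Rightarrow> complex) \<Rightarrow> (int \<Rightarrow> complex) \<Rightarrow> (int \<Rightarrow> complex)" where
  "cmv_W \<alpha> x = (\<lambda>j. if odd j then (theta \<alpha> j *v vector [x (j - 1), x j]) $ 2
                            else (theta \<alpha> (j + 1) *v vector [x j, x (j + 1)]) $ 1)"

definition cmv :: "(int \<Rightarrow> complex) \<Rightarrow> (int \<Rightarrow> complex) \<Rightarrow> (int \<Rightarrow> complex)" where
  "cmv \<alpha> = cmv_V \<alpha> \<circ> cmv_W \<alpha>"

text \<open>The half-lattice operators are restrictions, to \<open>ell2 {k..}\<close> and \<open>ell2 {..k}\<close>, of the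
  operator with a modified coefficient; the lemmas confirm that these subspaces are invariant,
  so that the modified operator splits as a direct sum.\<close>

definition cmv_plus :: "(int \<Rightarrow> complex) \<Rightarrow> int \<Rightarrow> (int \<Rightarrow> complex) \<Rightarrow> (int \<Rightarrow> complex)" where
  "cmv_plus \<alpha> k = cmv (\<alpha>(k := 1))"

definition cmv_minus :: "(int \<Rightarrow> complex) \<Rightarrow> int \<Rightarrow> (int \<Rightarrow> complex) \<Rightarrow> (int \<Rightarrow> complex)" where
  "cmv_minus \<alpha> k = cmv (\<alpha>(k + 1 := 1))"

lemma cmv_plus_support:
  assumes "\<forall>j. j \<notin> {k..} \<longrightarrow> x j = 0" "j \<notin> {k..}"
  shows "cmv_plus \<alpha> k x j = 0"
proof -
  have x: "x i = 0" if "i < k" for i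
    using assms(1) that by simp
  have W: "cmv_W (\<alpha>(k := 1)) x i = 0" if "i < k" for i
    using that x[of i] x[of "i - 1"] x[of "i + 1"]
    by (cases "i + 1 = k")
       (auto simp: cmv_W_def theta_def rho_def matrix_vector_mult_def sum_2)
  have "j < k"
    using assms(2) by simp
  then show ?thesis
    using W[of j] W[of "j - 1"] W[of "j + 1"]
    by (cases "j + 1 = k")
       (auto simp: cmv_plus_def cmv_def cmv_V_def theta_def rho_def matrix_vector_mult_def sum_2)
qed

lemma cmv_minus_support:
  assumes "\<forall>j. j \<notin> {..k} \<longrightarrow> x j = 0" "j \<notin> {..k}"
  shows "cmv_minus \<alpha> k x j = 0"
proof -
  have x: "x i = 0" if "i > k" for i
    using assms(1) that by simp
  have W: "cmv_W (\<alpha>(k + 1 := 1)) x i = 0" if "i > k" for i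
    using that x[of i] x[of "i - 1"] x[of "i + 1"]
    by (cases "i = k + 1")
       (auto simp: cmv_W_def theta_def rho_def matrix_vector_mult_def sum_2)
  have "j > k"
    using assms(2) by simp
  then show ?thesis
    using W[of j] W[of "j - 1"] W[of "j + 1"]
    by (cases "j = k + 1")
       (auto simp: cmv_minus_def cmv_def cmv_V_def theta_def rho_def matrix_vector_mult_def sum_2)
qed

section \<open>Weyl--Titchmarsh functions and reflectionless coefficients\<close>

definition cayley ::
  "(int \<Rightarrow> complex) set \<Rightarrow> ((int \<Rightarrow> complex) \<Rightarrow> (int \<Rightarrow> complex)) \<Rightarrow> complex \<Rightarrow>
    (int \<Rightarrow> complex) \<Rightarrow> (int \<Rightarrow> complex)" where
  "cayley H T z y = (\<lambda>j. T (resolvent H T z y) j + z * resolvent H T z y j)"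

definition m_plus :: "(int \<Rightarrow> complex) \<Rightarrow> complex \<Rightarrow> int \<Rightarrow> complex" where
  "m_plus \<alpha> z k =
     ell2_inner (ell2_delta k) (cayley (ell2 {k..}) (cmv_plus \<alpha> k) z (ell2_delta k))"

definition m_minus :: "(int \<Rightarrow> complex) \<Rightarrow> complex \<Rightarrow> int \<Rightarrow> complex" where
  "m_minus \<alpha> z k =
     - ell2_inner (ell2_delta k) (cayley (ell2 {..k}) (cmv_minus \<alpha> k) z (ell2_delta k))"

definition M_plus :: "(int \<Rightarrow> complex) \<Rightarrow> complex \<Rightarrow> int \<Rightarrow> complex" where
  "M_plus \<alpha> z k = m_plus \<alpha> z k"

definition M_minus :: "(int \<Rightarrow> complex) \<Rightarrow> complex \<Rightarrow> int \<Rightarrow> complex" where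
  "M_minus \<alpha> z k =
    (let a = 1 + \<alpha> k; b = 1 - \<alpha> k in
      (complex_of_real (Re a) + \<i> * complex_of_real (Im b) * m_minus \<alpha> z (k - 1)) /
      (\<i> * complex_of_real (Im a) + complex_of_real (Re b) * m_minus \<alpha> z (k - 1)))"

definition circle_measure :: "complex measure" where
  "circle_measure = distr (uniform_measure lborel {0..<2 * pi}) borel cis"

definition has_radial_limit :: "(complex \<Rightarrow> complex) \<Rightarrow> complex \<Rightarrow> complex \<Rightarrow> bool" where
  "has_radial_limit f \<zeta> L \<longleftrightarrow> ((\<lambda>r. f (complex_of_real r * \<zeta>)) \<longlongrightarrow> L) (at_left 1)"

text \<open>The boundary values of \<open>M\<^sub>+\<close> and \<open>M\<^sub>-\<close> are radial limits. These exist almost everywhere,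
  so asking for them explicitly, as an identity between limits does, is no restriction.\<close>

definition reflectionless :: "(int \<Rightarrow> complex) \<Rightarrow> bool" where
  "reflectionless \<alpha> \<longleftrightarrow>
    (\<forall>k. AE \<zeta> in circle_measure. \<zeta> \<in> essential_spectrum (ell2 UNIV) (cmv \<alpha>) \<longrightarrow>
      (\<exists>Lp Lm. has_radial_limit (\<lambda>z. M_plus \<alpha> z k) \<zeta> Lp \<and>
               has_radial_limit (\<lambda>z. M_minus \<alpha> z k) \<zeta> Lm \<and> Lp = - cnj Lm))"

end

theory Submission
  imports Defs "HOL-Complex_Analysis.Complex_Analysis" "HOL-Real_Asymp.Real_Asymp"
begin

text \<open>Fix \<open>k\<close> and pass to the Schur functions
  \<open>s(z) = (M\<^sub>+(z,k) - 1) / (M\<^sub>+(z,k) + 1)\<close> and \<open>t(z) = (M\<^sub>-(z,k) + 1) / (M\<^sub>-(z,k) - 1)\<close>,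
  which are analytic and bounded by 1 on the unit disc because \<open>M\<^sub>+\<close> and \<open>-M\<^sub>-\<close> have positive real
  part there. Their values at the origin are \<open>s(0) = 0\<close> and \<open>t(0) = \<alpha>\<^sub>k\<close>. When the spectrum is the
  full circle, it is all essential, and reflectionlessness says that \<open>s = cnj t\<close> almost everywhere
  on the circle. Then \<open>s t\<close> has the nonnegative boundary values \<open>\<bar>t\<bar>\<^sup>2\<close>, whereas their mean is
  \<open>s(0) t(0) = 0\<close>; so \<open>t\<close> vanishes almost everywhere on the circle, and its mean
  \<open>t(0) = \<alpha>\<^sub>k\<close> is zero. This is \<open>conjugate_boundary_values_imp_zero\<close> together with
  \<open>reflectionless_pair_value_at_zero\<close>.

  The operator-theoretic input is that \<open>\<plusminus>m\<^sub>\<plusminus>\<close> are Caratheodory functions: they are analytic because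
  the resolvent of a unitary operator is a Neumann series on the disc (\<open>resolvent_eq_neumann\<close>), their
  real parts are positive because the operators are isometric (\<open>Re_caratheodory_pos\<close>), and they are
  1 at the origin. Positivity of the real part of \<open>-M\<^sub>-\<close> follows by computing the fractional
  linear map that produces it from \<open>m\<^sub>-\<close> (\<open>Re_weyl_transform_neg\<close>).\<close>

section \<open>Square-summable sequences\<close>

lemma ell2_summable: "x \<in> ell2 K \<Longrightarrow> (\<lambda>j. (cmod (x j))\<^sup>2) summable_on UNIV"
  by (simp add: ell2_def)

lemma ell2_norm_square: "(ell2_norm x)\<^sup>2 = (\<Sum>\<^sub>\<infinity>j. (cmod (x j))\<^sup>2)"
  by (simp add: ell2_norm_def infsum_nonneg)

lemma ell2_norm_nonneg: "ell2_norm x \<ge> 0"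
  by (simp add: ell2_norm_def infsum_nonneg)

lemma L2_set_le_ell2_norm:
  assumes "x \<in> ell2 K"
  shows "L2_set (\<lambda>j. cmod (x j)) A \<le> ell2_norm x"
proof (cases "finite A")
  case True
  then show ?thesis
    unfolding L2_set_def ell2_norm_def
    by (intro real_sqrt_le_mono finite_sum_le_infsum ell2_summable[OF assms]) auto
qed (simp add: ell2_norm_nonneg)

lemma cmod_le_ell2_norm:
  assumes "x \<in> ell2 K"
  shows "cmod (x j) \<le> ell2_norm x"
  using L2_set_le_ell2_norm[OF assms, of "{j}"] by (simp add: L2_set_def)

lemma ell2_norm_eq_0D:
  assumes "x \<in> ell2 K" "ell2_norm x = 0"
  shows "x j = 0"
  using cmod_le_ell2_norm[OF assms(1), of j] assms(2) by simp

lemma ell2_scale: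
  assumes "x \<in> ell2 K"
  shows "(\<lambda>j. c * x j) \<in> ell2 K"
  using assms by (auto simp: ell2_def norm_mult power_mult_distrib intro: summable_on_cmult_right)

lemma ell2_norm_scale: "ell2_norm (\<lambda>j. c * x j) = cmod c * ell2_norm x"
  by (simp add: ell2_norm_def norm_mult power_mult_distrib infsum_cmult_right' real_sqrt_mult)

lemma ell2_diff:
  assumes "x \<in> ell2 K" "y \<in> ell2 K"
  shows "(\<lambda>j. x j - y j) \<in> ell2 K"
proof -
  have "(\<lambda>j. 2 * (cmod (x j))\<^sup>2 + 2 * (cmod (y j))\<^sup>2) summable_on UNIV"
    using assms by (intro summable_on_add summable_on_cmult_right ell2_summable)
  moreover have "(cmod (a - b))\<^sup>2 \<le> 2 * (cmod a)\<^sup>2 + 2 * (cmod b)\<^sup>2" for a b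
  proof -
    have "(cmod (a - b))\<^sup>2 \<le> (cmod a + cmod b)\<^sup>2"
      by (intro power_mono norm_triangle_ineq4) simp
    also have "\<dots> \<le> 2 * (cmod a)\<^sup>2 + 2 * (cmod b)\<^sup>2"
      using zero_le_power2[of "cmod a - cmod b"] by (simp add: power2_eq_square algebra_simps)
    finally show ?thesis .
  qed
  ultimately have "(\<lambda>j. (cmod (x j - y j))\<^sup>2) summable_on UNIV"
    by (rule summable_on_comparison_test) auto
  then show ?thesis
    using assms by (simp add: ell2_def)
qed

lemma ell2_delta_in: "k \<in> K \<Longrightarrow> ell2_delta k \<in> ell2 K"
  unfolding ell2_def ell2_delta_def
  by (auto intro!: has_sum_imp_summable[OF has_sum_finite_neutralI[of "{k}"]] split: if_splits)

lemma ell2_inner_delta: "ell2_inner (ell2_delta k) x = x k"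
proof -
  have "((\<lambda>j. cnj (ell2_delta k j) * x j) has_sum x k) UNIV"
    by (rule has_sum_finite_neutralI[of "{k}"]) (auto simp: ell2_delta_def)
  then show ?thesis
    by (simp add: ell2_inner_def infsumI)
qed

text \<open>Fatou's lemma for counting measure; it stands in for the completeness of \<open>\<ell>\<^sup>2\<close>
  when a series is summed coordinate by coordinate.\<close>

lemma ell2_pointwise_limit:
  assumes supp: "\<And>j. j \<notin> K \<Longrightarrow> x j = 0"
    and lim: "\<And>j. (\<lambda>n. s n j) \<longlonglongrightarrow> x j"
    and bound: "\<And>A n. finite A \<Longrightarrow> L2_set (\<lambda>j. cmod (s n j)) A \<le> C"
  shows "x \<in> ell2 K"
proof -
  have "sum (\<lambda>j. (cmod (x j))\<^sup>2) A \<le> C\<^sup>2" if "finite A" for A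
  proof -
    have "L2_set (\<lambda>j. cmod (x j)) A \<le> C"
    proof (rule tendsto_upperbound)
      show "(\<lambda>n. L2_set (\<lambda>j. cmod (s n j)) A) \<longlonglongrightarrow> L2_set (\<lambda>j. cmod (x j)) A"
        unfolding L2_set_def by (intro tendsto_intros lim)
    qed (use bound[OF that] in auto)
    then have "(L2_set (\<lambda>j. cmod (x j)) A)\<^sup>2 \<le> C\<^sup>2"
      by (rule power_mono) simp
    then show ?thesis
      by (simp add: L2_set_def sum_nonneg)
  qed
  then have "(\<lambda>j. (cmod (x j))\<^sup>2) summable_on UNIV"
    by (intro nonneg_bdd_above_summable_on bdd_aboveI[of _ "C\<^sup>2"]) auto
  with supp show ?thesis
    by (simp add: ell2_def)
qed

section \<open>Unitary operators and their Cayley transforms\<close>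

text \<open>The Caratheodory function of the spectral measure of \<open>\<delta>\<^sub>k\<close>, of which \<open>m\<^sub>+\<close> and \<open>-m\<^sub>-\<close> are
  instances.\<close>

definition caratheodory ::
  "int set \<Rightarrow> ((int \<Rightarrow> complex) \<Rightarrow> (int \<Rightarrow> complex)) \<Rightarrow> int \<Rightarrow> complex \<Rightarrow> complex" where
  "caratheodory K T k z = ell2_inner (ell2_delta k) (cayley (ell2 K) T z (ell2_delta k))"

text \<open>A unitary operator given with its inverse \<open>T'\<close>. Linearity and continuity are expressed
  coordinatewise, on all sequences: \<open>T\<close> commutes with every coordinatewise convergent series.
  Operators whose matrices have finitely many nonzero entries in each row have this property.\<close>

locale ell2_unitary =
  fixes K :: "int set" and T T' :: "(int \<Rightarrow> complex) \<Rightarrow> (int \<Rightarrow> complex)"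
  assumes T_in: "x \<in> ell2 K \<Longrightarrow> T x \<in> ell2 K"
    and T'_in: "x \<in> ell2 K \<Longrightarrow> T' x \<in> ell2 K"
    and norm_T: "x \<in> ell2 K \<Longrightarrow> ell2_norm (T x) = ell2_norm x"
    and T_T': "x \<in> ell2 K \<Longrightarrow> T (T' x) = x"
    and T_scale: "T (\<lambda>j. c * x j) = (\<lambda>j. c * T x j)"
    and T_diff: "T (\<lambda>j. x j - y j) = (\<lambda>j. T x j - T y j)"
    and T_sums: "(\<And>i. (\<lambda>n. f n i) sums g i) \<Longrightarrow> (\<lambda>n. T (f n) j) sums T g j"
begin

lemma T'_pow:
  assumes "y \<in> ell2 K"
  shows "(T' ^^ n) y \<in> ell2 K" "ell2_norm ((T' ^^ n) y) = ell2_norm y"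
proof -
  show *: "(T' ^^ n) y \<in> ell2 K" for n
    by (induction n) (auto intro: T'_in assms)
  show "ell2_norm ((T' ^^ n) y) = ell2_norm y"
    by (induction n) (auto simp: T_T' * T'_in norm_T[symmetric, of "T' _"])
qed

text \<open>The resolvent is \<open>(T - z)\<inverse> = T'(1 - z T')\<inverse>\<close>, expanded in a geometric series. Summing it
  in each coordinate shows at once that the entries of the resolvent are power series in \<open>z\<close>.\<close>

definition neumann :: "complex \<Rightarrow> (int \<Rightarrow> complex) \<Rightarrow> (int \<Rightarrow> complex)" where
  "neumann z y = (\<lambda>j. \<Sum>n. z ^ n * (T' ^^ Suc n) y j)"

lemma neumann_sums:
  assumes y: "y \<in> ell2 K" and z: "cmod z < 1"
  shows "(\<lambda>n. z ^ n * (T' ^^ Suc n) y j) sums neumann z y j"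
proof -
  have "summable (\<lambda>n. z ^ n * (T' ^^ Suc n) y j)"
  proof (rule summable_comparison_test')
    show "summable (\<lambda>n. cmod z ^ n * ell2_norm y)"
      using z by (intro summable_mult2 summable_geometric) simp
    show "norm (z ^ n * (T' ^^ Suc n) y j) \<le> cmod z ^ n * ell2_norm y" for n
      using cmod_le_ell2_norm[OF T'_pow(1)[OF y, of "Suc n"], of j] T'_pow(2)[OF y, of "Suc n"]
      by (auto simp: norm_mult norm_power intro!: mult_left_mono)
  qed
  then show ?thesis
    unfolding neumann_def by (rule summable_sums)
qed

lemma neumann_in:
  assumes y: "y \<in> ell2 K" and z: "cmod z < 1"
  shows "neumann z y \<in> ell2 K"
proof (rule ell2_pointwise_limit)
  show "neumann z y j = 0" if "j \<notin> K" for j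
    using that T'_pow(1)[OF y, of "Suc _"] by (simp add: neumann_def ell2_def del: funpow.simps)
  show "(\<lambda>N. \<Sum>n<N. z ^ n * (T' ^^ Suc n) y j) \<longlonglongrightarrow> neumann z y j" for j
    using neumann_sums[OF assms] by (simp only: sums_def)
  fix A :: "int set" and N :: nat
  assume "finite A"
  have "L2_set (\<lambda>j. cmod (\<Sum>n<N. z ^ n * (T' ^^ Suc n) y j)) A \<le> (\<Sum>n<N. cmod z ^ n) * ell2_norm y"
  proof (induction N)
    case (Suc N)
    let ?s = "\<lambda>j. \<Sum>n<N. z ^ n * (T' ^^ Suc n) y j"
    let ?t = "\<lambda>j. z ^ N * (T' ^^ Suc N) y j"
    have t: "L2_set (\<lambda>j. cmod (?t j)) A \<le> cmod z ^ N * ell2_norm y"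
      using L2_set_le_ell2_norm[OF ell2_scale[OF T'_pow(1)[OF y, of "Suc N"]], of "z ^ N" A]
      by (simp only: ell2_norm_scale T'_pow(2)[OF y] norm_power)
    have "L2_set (\<lambda>j. cmod (?s j + ?t j)) A \<le> L2_set (\<lambda>j. cmod (?s j) + cmod (?t j)) A"
      by (intro L2_set_mono norm_triangle_ineq) simp
    also have "\<dots> \<le> L2_set (\<lambda>j. cmod (?s j)) A + L2_set (\<lambda>j. cmod (?t j)) A"
      by (rule L2_set_triangle_ineq)
    also have "\<dots> \<le> (\<Sum>n<N. cmod z ^ n) * ell2_norm y + cmod z ^ N * ell2_norm y"
      by (intro add_mono Suc.IH t)
    finally show ?case
      by (simp add: algebra_simps del: funpow.simps)
  qed (simp add: L2_set_def)
  also have "(\<Sum>n<N. cmod z ^ n) * ell2_norm y \<le> (1 / (1 - cmod z)) * ell2_norm y"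
  proof (rule mult_right_mono[OF _ ell2_norm_nonneg])
    have "(\<Sum>n<N. cmod z ^ n) \<le> (\<Sum>n. cmod z ^ n)"
      using z by (intro sum_le_suminf summable_geometric) auto
    then show "(\<Sum>n<N. cmod z ^ n) \<le> 1 / (1 - cmod z)"
      using z by (simp add: suminf_geometric)
  qed
  finally show "L2_set (\<lambda>j. cmod (\<Sum>n<N. z ^ n * (T' ^^ Suc n) y j)) A \<le> 1 / (1 - cmod z) * ell2_norm y" .
qed

text \<open>Applying \<open>T\<close> lowers every power of \<open>T'\<close> by one, so the series telescopes.\<close>

lemma T_neumann:
  assumes y: "y \<in> ell2 K" and z: "cmod z < 1"
  shows "T (neumann z y) j = y j + z * neumann z y j"
proof -
  let ?f = "\<lambda>n. z ^ n * (T' ^^ n) y j"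
  have "T (\<lambda>i. z ^ n * (T' ^^ Suc n) y i) j = ?f n" for n
    using T_T'[OF T'_pow(1)[OF y, of n]] by (simp add: T_scale)
  then have "?f sums T (neumann z y) j"
    using T_sums[where j = j and f = "\<lambda>n i. z ^ n * (T' ^^ Suc n) y i" and g = "neumann z y",
      OF neumann_sums[OF assms]] by simp
  moreover have "(\<lambda>n. ?f (Suc n)) sums (z * neumann z y j)"
    using sums_mult[where c = z, OF neumann_sums[where j = j, OF assms]] by (simp add: mult.assoc)
  then have "?f sums (z * neumann z y j + ?f 0)"
    by (rule sums_Suc)
  ultimately show ?thesis
    using sums_unique2 by fastforce
qed

text \<open>A difference \<open>w\<close> of two solutions satisfies \<open>T w = z w\<close>, which for an isometry and
  \<open>\<bar>z\<bar> < 1\<close> forces \<open>w = 0\<close>; hence the inverse chosen by the resolvent is the Neumann series.\<close>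

lemma resolvent_eq_neumann:
  assumes y: "y \<in> ell2 K" and z: "cmod z < 1"
  shows "resolvent (ell2 K) T z y = neumann z y"
proof -
  have inj: "inj_on (\<lambda>x j. T x j - z * x j) (ell2 K)"
  proof (rule inj_onI)
    fix u v assume uv: "u \<in> ell2 K" "v \<in> ell2 K" "(\<lambda>j. T u j - z * u j) = (\<lambda>j. T v j - z * v j)"
    define w where "w = (\<lambda>j. u j - v j)"
    have w: "w \<in> ell2 K"
      unfolding w_def by (rule ell2_diff[OF uv(1,2)])
    have "T w = (\<lambda>j. z * w j)"
    proof
      fix j show "T w j = z * w j"
        using fun_cong[OF uv(3), of j] by (simp add: w_def T_diff algebra_simps)
    qed
    then have "ell2_norm w = cmod z * ell2_norm w"
      using norm_T[OF w] by (simp add: ell2_norm_scale)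
    then have "ell2_norm w = 0"
      using z by auto
    then show "u = v"
      using ell2_norm_eq_0D[OF w] by (auto simp: w_def)
  qed
  have "y = (\<lambda>x j. T x j - z * x j) (neumann z y)"
    using T_neumann[OF assms] by auto
  then show ?thesis
    unfolding resolvent_def using inv_into_f_f[OF inj neumann_in[OF assms]] by simp
qed

lemma cayley_eq:
  assumes "y \<in> ell2 K" "cmod z < 1"
  shows "cayley (ell2 K) T z y j = y j + 2 * z * neumann z y j"
  using T_neumann[OF assms] by (simp add: cayley_def resolvent_eq_neumann[OF assms])

lemma neumann_holomorphic:
  assumes "y \<in> ell2 K"
  shows "(\<lambda>z. neumann z y j) holomorphic_on ball 0 1"
proof (rule power_series_holomorphic)
  show "(\<lambda>n. (T' ^^ Suc n) y j * (z - 0) ^ n) sums neumann z y j" if "z \<in> ball 0 1" for z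
    using neumann_sums[OF assms, of z j] that by (simp add: mult.commute)
qed

lemma caratheodory_eq:
  assumes "k \<in> K" "cmod z < 1"
  shows "caratheodory K T k z = 1 + 2 * z * neumann z (ell2_delta k) k"
  using cayley_eq[OF ell2_delta_in[OF assms(1)] assms(2)]
  by (simp add: caratheodory_def ell2_inner_delta) (simp add: ell2_delta_def)

lemma caratheodory_0: "k \<in> K \<Longrightarrow> caratheodory K T k 0 = 1"
  by (simp add: caratheodory_eq)

lemma caratheodory_holomorphic:
  assumes "k \<in> K"
  shows "caratheodory K T k holomorphic_on ball 0 1"
proof (rule holomorphic_transform)
  show "(\<lambda>z. 1 + 2 * z * neumann z (ell2_delta k) k) holomorphic_on ball 0 1"
    by (intro holomorphic_intros neumann_holomorphic ell2_delta_in assms)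
qed (simp add: caratheodory_eq assms)

text \<open>With \<open>x = (T - z)\<inverse> \<delta>\<^sub>k\<close> one has \<open>T x = \<delta>\<^sub>k + z x\<close>. Comparing the norms of both sides,
  with \<open>\<parallel>T x\<parallel> = \<parallel>x\<parallel>\<close>, evaluates the real part as \<open>(1 - \<bar>z\<bar>\<^sup>2) \<parallel>x\<parallel>\<^sup>2\<close>.\<close>

lemma Re_caratheodory_pos:
  assumes k: "k \<in> K" and z: "cmod z < 1"
  shows "Re (caratheodory K T k z) > 0"
proof -
  define x where "x = neumann z (ell2_delta k)"
  have x: "x \<in> ell2 K"
    unfolding x_def by (rule neumann_in[OF ell2_delta_in[OF k] z])
  have Tx: "T x j = ell2_delta k j + z * x j" for j
    unfolding x_def by (rule T_neumann[OF ell2_delta_in[OF k] z])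
  have "((\<lambda>j. (cmod (T x j))\<^sup>2 + - (cmod (z * x j))\<^sup>2) has_sum
          ((ell2_norm (T x))\<^sup>2 + - (ell2_norm (\<lambda>j. z * x j))\<^sup>2)) UNIV"
    unfolding ell2_norm_square
    by (intro has_sum_add has_sum_uminusI has_sum_infsum ell2_summable[OF T_in[OF x]]
          ell2_summable[OF ell2_scale[OF x]])
  then have "((\<lambda>j. (cmod (T x j))\<^sup>2 - (cmod (z * x j))\<^sup>2) has_sum
          ((ell2_norm (T x))\<^sup>2 - (ell2_norm (\<lambda>j. z * x j))\<^sup>2)) UNIV"
    by simp
  \<comment> \<open>The sequences \<open>T x\<close> and \<open>z x\<close> differ in the coordinate \<open>k\<close> only.\<close>
  moreover have "((\<lambda>j. (cmod (T x j))\<^sup>2 - (cmod (z * x j))\<^sup>2) has_sum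
          ((cmod (1 + z * x k))\<^sup>2 - (cmod (z * x k))\<^sup>2)) UNIV"
    by (rule has_sum_finite_neutralI[of "{k}"]) (auto simp: Tx ell2_delta_def)
  ultimately have "(ell2_norm (T x))\<^sup>2 - (ell2_norm (\<lambda>j. z * x j))\<^sup>2
      = (cmod (1 + z * x k))\<^sup>2 - (cmod (z * x k))\<^sup>2"
    by (rule has_sum_unique)
  also have "\<dots> = Re (1 + 2 * z * x k)"
    by (simp add: cmod_power2) (simp add: power2_eq_square algebra_simps)
  also have "\<dots> = Re (caratheodory K T k z)"
    by (simp add: caratheodory_eq[OF k z] x_def)
  finally have "Re (caratheodory K T k z) = (1 - (cmod z)\<^sup>2) * (ell2_norm x)\<^sup>2"
    by (simp add: norm_T[OF x] ell2_norm_scale power_mult_distrib algebra_simps)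
  moreover have "ell2_norm x \<noteq> 0"
  proof
    assume *: "ell2_norm x = 0"
    then have "ell2_norm (T x) = 0"
      by (simp add: norm_T[OF x])
    from ell2_norm_eq_0D[OF T_in[OF x] this, of k] ell2_norm_eq_0D[OF x *, of k] Tx[of k] 
    show False
      by (simp add: ell2_delta_def)
  qed
  moreover have "(cmod z)\<^sup>2 < 1"
    using z by (simp add: power_less_one_iff)
  ultimately show ?thesis
    by simp
qed

end

section \<open>Unitarity of CMV operators on invariant index sets\<close>

text \<open>Both factors of a CMV operator are direct sums of the blocks \<open>\<theta>\<^sub>n\<close> on the indices
  \<open>{n - 1, n}\<close>; the predicate selects the parity of \<open>n\<close>, so that the two factors are treated at once.\<close>

definition block_op :: "(int \<Rightarrow> bool) \<Rightarrow> (int \<Rightarrow> complex) \<Rightarrow> (int \<Rightarrow> complex) \<Rightarrow> (int \<Rightarrow> complex)" where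
  "block_op P \<alpha> x = (\<lambda>j. if P j then complex_of_real (rho \<alpha> j) * x (j - 1) + cnj (\<alpha> j) * x j
     else - \<alpha> (j + 1) * x j + complex_of_real (rho \<alpha> (j + 1)) * x (j + 1))"

lemma cmv_V_eq: "cmv_V \<alpha> = block_op even \<alpha>"
  and cmv_W_eq: "cmv_W \<alpha> = block_op odd \<alpha>"
  by (auto simp: cmv_V_def cmv_W_def block_op_def theta_def matrix_vector_mult_def sum_2 fun_eq_iff)

lemma block_op_sums:
  assumes "\<And>i. (\<lambda>n. f n i) sums g i"
  shows "(\<lambda>n. block_op P \<alpha> (f n) j) sums block_op P \<alpha> g j"
  by (auto simp: block_op_def intro!: sums_add sums_diff sums_mult assms)

lemma block_op_scale: "block_op P \<alpha> (\<lambda>j. c * x j) = (\<lambda>j. c * block_op P \<alpha> x j)"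
  by (auto simp: block_op_def fun_eq_iff algebra_simps)

lemma block_op_diff: "block_op P \<alpha> (\<lambda>j. x j - y j) = (\<lambda>j. block_op P \<alpha> x j - block_op P \<alpha> y j)"
  by (auto simp: block_op_def fun_eq_iff algebra_simps)

lemma rho_cnj [simp]: "rho (\<lambda>j. cnj (\<alpha> j)) k = rho \<alpha> k"
  by (simp add: rho_def)

lemma rho_square:
  assumes "cmod (\<alpha> k) \<le> 1"
  shows "complex_of_real (rho \<alpha> k) * complex_of_real (rho \<alpha> k) = 1 - \<alpha> k * cnj (\<alpha> k)"
proof -
  have "(cmod (\<alpha> k))\<^sup>2 \<le> 1"
    using assms by (simp add: power_le_one_iff)
  then have "rho \<alpha> k * rho \<alpha> k = 1 - (cmod (\<alpha> k))\<^sup>2"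
    by (simp add: rho_def)
  then have "complex_of_real (rho \<alpha> k * rho \<alpha> k) = complex_of_real (1 - (cmod (\<alpha> k))\<^sup>2)"
    by simp
  then show ?thesis
    by (simp only: of_real_mult of_real_diff complex_norm_square of_real_1)
qed

text \<open>The matrices \<open>\<theta>\<^sub>n\<close> are symmetric and unitary, so their inverses arise by conjugating \<open>\<alpha>\<close>.\<close>

lemma block_op_inverse:
  assumes \<alpha>: "\<And>k. cmod (\<alpha> k) \<le> 1" and P: "\<And>j. P (j + 1) \<longleftrightarrow> \<not> P j"
  shows "block_op P \<alpha> (block_op P (\<lambda>j. cnj (\<alpha> j)) x) = x"
proof
  fix j
  have theta_inv: "r * (- b * u + r * v) + b * (r * u + a * v) = v" "- a * (- b * u + r * v) + r * (r * u + a * v) = u"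
    if "r * r = 1 - a * b" for r a b u v :: complex
  proof -
    have "r * (- b * u + r * v) + b * (r * u + a * v) = (r * r + a * b) * v"
      "- a * (- b * u + r * v) + r * (r * u + a * v) = (r * r + a * b) * u"
      by (simp_all add: algebra_simps)
    then show "r * (- b * u + r * v) + b * (r * u + a * v) = v" "- a * (- b * u + r * v) + r * (r * u + a * v) = u"
      by (simp_all add: that)
  qed
  show "block_op P \<alpha> (block_op P (\<lambda>j. cnj (\<alpha> j)) x) j = x j"
  proof (cases "P j")
    case True
    then have "\<not> P (j - 1)"
      using P[of "j - 1"] by simp
    then show ?thesis
      using True theta_inv(1)[OF rho_square, of \<alpha> j "x (j - 1)" "x j"] \<alpha>[of j]
      by (simp add: block_op_def)
  next
    case False
    then have "P (j + 1)"
      using P[of j] by simp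
    then show ?thesis
      using False theta_inv(2)[OF rho_square, of \<alpha> "j + 1" "x j" "x (j + 1)"] \<alpha>[of "j + 1"]
      by (simp add: block_op_def)
  qed
qed

lemma theta_isometric:
  assumes "cmod (\<alpha> k) \<le> 1"
  shows "(cmod (- \<alpha> k * u + complex_of_real (rho \<alpha> k) * v))\<^sup>2
       + (cmod (complex_of_real (rho \<alpha> k) * u + cnj (\<alpha> k) * v))\<^sup>2 = (cmod u)\<^sup>2 + (cmod v)\<^sup>2"
proof -
  have *: "(- a * u + r * v) * (- b * u' + r * v') + (r * u + b * v) * (r * u' + a * v') = u * u' + v * v'"
    if "r * r = 1 - a * b" for r a b u v u' v' :: complex
  proof -
    have "(- a * u + r * v) * (- b * u' + r * v') + (r * u + b * v) * (r * u' + a * v')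
        = (r * r + a * b) * (u * u' + v * v')"
      by (simp add: algebra_simps)
    then show ?thesis
      by (simp add: that)
  qed
  have "complex_of_real ((cmod (- \<alpha> k * u + complex_of_real (rho \<alpha> k) * v))\<^sup>2
       + (cmod (complex_of_real (rho \<alpha> k) * u + cnj (\<alpha> k) * v))\<^sup>2)
       = complex_of_real ((cmod u)\<^sup>2 + (cmod v)\<^sup>2)"
    using *[OF rho_square[of \<alpha> k, OF assms], of u v "cnj u" "cnj v"]
    by (simp only: of_real_add complex_norm_square complex_cnj_add complex_cnj_mult complex_cnj_minus
        complex_cnj_cnj complex_cnj_complex_of_real)
  then show ?thesis
    by (simp only: of_real_eq_iff)
qed

lemma infsum_pairs:
  fixes f :: "int \<Rightarrow> real"
  assumes f: "f summable_on UNIV" and P: "\<And>j. P (j + 1) \<longleftrightarrow> \<not> P j"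
  shows "infsum f UNIV = (\<Sum>\<^sub>\<infinity>j\<in>Collect P. f (j - 1) + f j)"
proof -
  have P': "P (j - 1) \<longleftrightarrow> \<not> P j" for j
    using P[of "j - 1"] by simp
  have bij: "bij_betw (\<lambda>j. j - 1) (Collect P) (- Collect P)"
    by (rule bij_betwI[of _ _ _ "\<lambda>j. j + 1"]) (use P P' in auto)
  have s: "f summable_on A" for A
    using f by (rule summable_on_subset) auto
  have "infsum f UNIV = infsum f (Collect P) + infsum f (- Collect P)"
    using infsum_Un_disjoint[OF s s, of "Collect P" "- Collect P"] by simp
  also have "infsum f (- Collect P) = (\<Sum>\<^sub>\<infinity>j\<in>Collect P. f (j - 1))"
    using infsum_reindex_bij_betw[OF bij, of f] by simp
  also have "infsum f (Collect P) + \<dots> = (\<Sum>\<^sub>\<infinity>j\<in>Collect P. f (j - 1) + f j)"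
    using s summable_on_reindex_bij_betw[OF bij, of f] by (subst infsum_add) auto
  finally show ?thesis .
qed

text \<open>The operator preserves \<open>\<ell>\<^sup>2(K)\<close> when no block couples \<open>K\<close> to its complement: where a block
  straddles the boundary of \<open>K\<close>, its off-diagonal entry \<open>\<rho>\<close> has to vanish. This covers the whole
  lattice and both half-lattices.\<close>

lemma block_op_ell2:
  assumes \<alpha>: "\<And>k. cmod (\<alpha> k) \<le> 1" and P: "\<And>j. P (j + 1) \<longleftrightarrow> \<not> P j"
    and K: "\<And>j. (j - 1 \<in> K) \<noteq> (j \<in> K) \<Longrightarrow> rho \<alpha> j = 0"
    and x: "x \<in> ell2 K"
  shows "block_op P \<alpha> x \<in> ell2 K" "ell2_norm (block_op P \<alpha> x) = ell2_norm x"
proof -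
  let ?y = "block_op P \<alpha> x"
  have pair: "(cmod (?y (j - 1)))\<^sup>2 + (cmod (?y j))\<^sup>2 = (cmod (x (j - 1)))\<^sup>2 + (cmod (x j))\<^sup>2" if "P j" for j
    using theta_isometric[of \<alpha> j] \<alpha> that P[of "j - 1"] by (simp add: block_op_def)
  have le: "(cmod (?y j))\<^sup>2 \<le> (cmod (x (j - 1)))\<^sup>2 + (cmod (x j))\<^sup>2 + (cmod (x (j + 1)))\<^sup>2" for j
  proof (cases "P j")
    case True
    then show ?thesis
      using pair[OF True] zero_le_power2[of "cmod (?y (j - 1))"] zero_le_power2[of "cmod (x (j + 1))"]
      by linarith
  next
    case False
    then have "(cmod (?y j))\<^sup>2 + (cmod (?y (j + 1)))\<^sup>2 = (cmod (x j))\<^sup>2 + (cmod (x (j + 1)))\<^sup>2"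
      using pair[of "j + 1"] P[of j] by simp
    then show ?thesis
      using zero_le_power2[of "cmod (?y (j + 1))"] zero_le_power2[of "cmod (x (j - 1))"]
      by linarith
  qed
  have sx: "(\<lambda>j. (cmod (x j))\<^sup>2) summable_on UNIV"
    using x by (rule ell2_summable)
  have shift: "(\<lambda>j. (cmod (x (j + d)))\<^sup>2) summable_on UNIV" for d
    by (subst summable_on_reindex_bij_betw[of "\<lambda>j. j + d" UNIV UNIV])
       (auto intro: sx bij_betwI[of _ _ _ "\<lambda>j. j - d"])
  have "(\<lambda>j. (cmod (x (j - 1)))\<^sup>2 + (cmod (x j))\<^sup>2 + (cmod (x (j + 1)))\<^sup>2) summable_on UNIV"
    using shift[of "- 1"] shift[of 1] sx by (intro summable_on_add) auto
  then have sy: "(\<lambda>j. (cmod (?y j))\<^sup>2) summable_on UNIV"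
    by (rule summable_on_comparison_test) (use le in auto)
  have "?y j = 0" if "j \<notin> K" for j
    using that x K[of j] K[of "j + 1"]
    by (cases "j - 1 \<in> K"; cases "j + 1 \<in> K") (auto simp: block_op_def ell2_def)
  with sy show "?y \<in> ell2 K"
    by (simp add: ell2_def)
  show "ell2_norm ?y = ell2_norm x"
    unfolding ell2_norm_def infsum_pairs[where P = P, OF sx P] infsum_pairs[where P = P, OF sy P]
    using pair by (auto intro!: infsum_cong)
qed

lemma cmv_unitary:
  assumes \<alpha>: "\<And>k. cmod (\<alpha> k) \<le> 1"
    and K: "\<And>j. (j - 1 \<in> K) \<noteq> (j \<in> K) \<Longrightarrow> rho \<alpha> j = 0"
  shows "ell2_unitary K (cmv \<alpha>) (cmv_W (\<lambda>j. cnj (\<alpha> j)) \<circ> cmv_V (\<lambda>j. cnj (\<alpha> j)))"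
proof -
  have eo: "even (j + 1) \<longleftrightarrow> \<not> even j" "odd (j + 1) \<longleftrightarrow> \<not> odd j" for j :: int
    by auto
  have b: "block_op even \<beta> x \<in> ell2 K" "ell2_norm (block_op even \<beta> x) = ell2_norm x"
    "block_op odd \<beta> x \<in> ell2 K" "ell2_norm (block_op odd \<beta> x) = ell2_norm x"
    if "x \<in> ell2 K" "\<beta> = \<alpha> \<or> \<beta> = (\<lambda>j. cnj (\<alpha> j))" for \<beta> x
  proof -
    have "cmod (\<beta> k) \<le> 1" for k
      using that(2) \<alpha> by auto
    moreover have "rho \<beta> j = 0" if "(j - 1 \<in> K) \<noteq> (j \<in> K)" for j
      using \<open>\<beta> = \<alpha> \<or> \<beta> = _\<close> K[OF that] by auto
    ultimately show "block_op even \<beta> x \<in> ell2 K" "ell2_norm (block_op even \<beta> x) = ell2_norm x"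
      "block_op odd \<beta> x \<in> ell2 K" "ell2_norm (block_op odd \<beta> x) = ell2_norm x"
      using block_op_ell2[where \<alpha> = \<beta> and x = x and P = even and K = K, OF _ eo(1) _ that(1)]
        block_op_ell2[where \<alpha> = \<beta> and x = x and P = odd and K = K, OF _ eo(2) _ that(1)] by auto
  qed
  show ?thesis
    unfolding cmv_def cmv_V_eq cmv_W_eq
  proof
    fix f :: "nat \<Rightarrow> int \<Rightarrow> complex" and g j
    assume "\<And>i. (\<lambda>n. f n i) sums g i"
    then show "(\<lambda>n. (block_op even \<alpha> \<circ> block_op odd \<alpha>) (f n) j) sums (block_op even \<alpha> \<circ> block_op odd \<alpha>) g j"
      unfolding comp_def by (intro block_op_sums)
  qed (auto simp: b block_op_inverse[where \<alpha> = \<alpha> and P = even, OF \<alpha> eo(1)] block_op_inverse[where \<alpha> = \<alpha> and P = odd, OF \<alpha> eo(2)] block_op_scale block_op_diff)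
qed

section \<open>Bounded analytic functions with conjugate boundary values\<close>

lemma borel_measurable_cis: "cis \<in> borel_measurable (uniform_measure lborel A)"
proof -
  have "cis \<in> borel_measurable borel"
    by (intro borel_measurable_continuous_onI continuous_intros)
  then show ?thesis
    by (simp cong: measurable_cong_sets)
qed


lemma circle_mean_value:
  assumes f: "f holomorphic_on ball 0 1" and r: "0 < r" "r < 1"
  shows "set_integrable lborel {0..2*pi} (\<lambda>x. f (complex_of_real r * cis x))"
    and "(LINT x:{0..2*pi}|lborel. f (complex_of_real r * cis x)) = 2 * complex_of_real pi * f 0"
proof -
  have sub: "cball 0 r \<subseteq> (ball 0 1 :: complex set)"
    using r by auto
  have "continuous_on (ball 0 1) f"
    using f by (rule holomorphic_on_imp_continuous_on)
  moreover have "continuous_on {0..2*pi} (\<lambda>x. complex_of_real r * cis x)"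
    by (intro continuous_intros)
  ultimately have "continuous_on {0..2*pi} (\<lambda>x. f (complex_of_real r * cis x))"
    by (rule continuous_on_compose2) (use r in \<open>auto simp: norm_mult\<close>)
  then show *: "set_integrable lborel {0..2*pi} (\<lambda>x. f (complex_of_real r * cis x))"
    by (rule borel_integrable_atLeastAtMost')
  have "((\<lambda>u. f u / (u - 0)) has_contour_integral (2 * of_real pi * \<i> * f 0)) (circlepath 0 r)"
    using r holomorphic_on_subset[OF f sub] by (intro Cauchy_integral_circlepath_simple) auto
  then have "((\<lambda>t. f (0 + complex_of_real r * cis t) / (0 + complex_of_real r * cis t - 0)
      * complex_of_real r * \<i> * cis t) has_integral (2 * of_real pi * \<i> * f 0)) {0..2*pi}"
    unfolding circlepath_def by (subst (asm) has_contour_integral_part_circlepath_iff) auto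
  then have "((\<lambda>t. \<i> * f (complex_of_real r * cis t)) has_integral (2 * of_real pi * \<i> * f 0)) {0..2*pi}"
    using r by (simp add: field_simps)
  from has_integral_mult_right[OF this, of "- \<i>"]
  have "((\<lambda>t. f (complex_of_real r * cis t)) has_integral (2 * of_real pi * f 0)) {0..2*pi}"
    by (simp add: mult.assoc[symmetric]) (simp add: algebra_simps)
  then show "(LINT x:{0..2*pi}|lborel. f (complex_of_real r * cis x)) = 2 * complex_of_real pi * f 0"
    using set_borel_integral_eq_integral(2)[OF *] by (simp add: integral_unique)
qed

lemma AE_circle_measureD:
  assumes "AE \<zeta> in circle_measure. P \<zeta>"
  shows "AE x in lborel. x \<in> {0..2*pi} \<longrightarrow> P (cis x)"
proof -
  have "AE x in uniform_measure lborel {0..<2*pi}. P (cis x)"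
    using assms unfolding circle_measure_def 
    by (rule AE_distrD[rotated]) (simp add: borel_measurable_cis)
  then have "AE x in lborel. x \<in> {0..<2*pi} \<longrightarrow> P (cis x)"
    by (subst (asm) AE_uniform_measure) auto
  with AE_lborel_singleton[of "2*pi"] show ?thesis
    by eventually_elim auto
qed

lemma AE_circle_measure_norm: "AE \<zeta> in circle_measure. cmod \<zeta> = 1"
  unfolding circle_measure_def by (subst AE_distr_iff) (auto simp: borel_measurable_cis)

text \<open>If \<open>p\<close> and \<open>q\<close> have conjugate boundary values, then \<open>p q\<close> has the boundary values \<open>\<bar>q\<bar>\<^sup>2\<close>.
  Their mean is \<open>p 0 * q 0 = 0\<close>, so \<open>q\<close> vanishes almost everywhere on the circle, and
  hence so does its mean \<open>q 0\<close>. Boundedness lets the mean value property pass from smaller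
  circles to the unit circle.\<close>

lemma conjugate_boundary_values_imp_zero:
  fixes p q :: "complex \<Rightarrow> complex"
  assumes p: "p holomorphic_on ball 0 1" "\<And>z. cmod z < 1 \<Longrightarrow> cmod (p z) \<le> 1"
    and q: "q holomorphic_on ball 0 1" "\<And>z. cmod z < 1 \<Longrightarrow> cmod (q z) \<le> 1"
    and p0: "p 0 = 0"
    and bd: "AE \<zeta> in circle_measure. \<exists>L. has_radial_limit p \<zeta> (cnj L) \<and> has_radial_limit q \<zeta> L"
  shows "q 0 = 0"
proof -
  define r :: "nat \<Rightarrow> real" where "r n = 1 - 1 / (real n + 2)" for n
  define I where "I = {0..2*pi}"
  have r: "0 < r n" "r n < 1" for n
    by (auto simp: r_def field_simps)
  have "r \<longlonglongrightarrow> 1"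
    unfolding r_def by real_asymp
  then have r_lim: "filterlim r (at_left 1) sequentially"
    using r by (auto simp: filterlim_at less_imp_neq)
  define u :: "nat \<Rightarrow> real \<Rightarrow> complex" where "u = (\<lambda>n x. indicat_real I x *\<^sub>R q (complex_of_real (r n) * cis x))"
  define v :: "nat \<Rightarrow> real \<Rightarrow> complex" where "v = (\<lambda>n x. indicat_real I x *\<^sub>R (p (complex_of_real (r n) * cis x) * q (complex_of_real (r n) * cis x)))"
  \<comment> \<open>The boundary function of \<open>q\<close>, written as a limit of measurable functions so that it is
    measurable.\<close>
  define l where "l x = lim (\<lambda>n. u n x)" for x
  have pq: "(\<lambda>z. p z * q z) holomorphic_on ball 0 1"
    using p(1) q(1) by (intro holomorphic_intros)
  have u_int: "integrable lborel (u n)" "integral\<^sup>L lborel (u n) = 2 * complex_of_real pi * q 0" for n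
    using circle_mean_value[OF q(1) r[of n]]
    by (auto simp: set_integrable_def set_lebesgue_integral_def u_def I_def)
  have v_int: "integrable lborel (v n)" "integral\<^sup>L lborel (v n) = 0" for n
    using circle_mean_value[OF pq r[of n]] p0
    by (auto simp: set_integrable_def set_lebesgue_integral_def v_def I_def)
  have um [measurable]: "u n \<in> borel_measurable lborel" for n
    using u_int(1) by auto
  have vm [measurable]: "v n \<in> borel_measurable lborel" for n
    using v_int(1) by auto
  have lm [measurable]: "l \<in> borel_measurable lborel"
    unfolding l_def by measurable
  have lims: "AE x in lborel. (\<lambda>n. u n x) \<longlonglongrightarrow> l x \<and>
      (\<lambda>n. v n x) \<longlonglongrightarrow> complex_of_real ((cmod (l x))\<^sup>2)"
    using AE_circle_measureD[OF bd]
  proof eventually_elim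
    case (elim x)
    show ?case
    proof (cases "x \<in> I")
      case True
      then obtain L where L: "has_radial_limit p (cis x) (cnj L)" "has_radial_limit q (cis x) L"
        using elim by (auto simp: I_def)
      have pl: "(\<lambda>n. p (complex_of_real (r n) * cis x)) \<longlonglongrightarrow> cnj L"
        using filterlim_compose[OF L(1)[unfolded has_radial_limit_def] r_lim] .
      have ql: "(\<lambda>n. q (complex_of_real (r n) * cis x)) \<longlonglongrightarrow> L"
        using filterlim_compose[OF L(2)[unfolded has_radial_limit_def] r_lim] .
      have "l x = L"
        using ql True by (auto simp: l_def u_def intro: limI)
      then show ?thesis
        using ql tendsto_mult[OF pl ql] True
        by (simp add: u_def v_def complex_norm_square[symmetric] mult.commute)
    next
      case False
      then have "l x = 0" by (auto simp: l_def u_def intro: limI)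
      then show ?thesis using False by (simp add: u_def v_def)
    qed
  qed
  have dom: "integrable lborel (indicat_real I)"
    by (simp add: I_def)
  have ub: "cmod (u n x) \<le> indicat_real I x" for n x
    using q(2)[of "complex_of_real (r n) * cis x"] r[of n]
    by (auto simp: u_def norm_mult indicator_def)
  have vb: "cmod (v n x) \<le> indicat_real I x" for n x
    using p(2)[of "complex_of_real (r n) * cis x"] q(2)[of "complex_of_real (r n) * cis x"] r[of n]
    by (auto simp: v_def norm_mult indicator_def intro!: mult_le_one)
  have L2: "integrable lborel (\<lambda>x. complex_of_real ((cmod (l x))\<^sup>2))"
    "(\<lambda>n. integral\<^sup>L lborel (v n)) \<longlonglongrightarrow> (LINT x|lborel. complex_of_real ((cmod (l x))\<^sup>2))"
  proof -
    have meas: "(\<lambda>x. complex_of_real ((cmod (l x))\<^sup>2)) \<in> borel_measurable lborel"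
      by measurable
    have lim: "AE x in lborel. (\<lambda>n. v n x) \<longlonglongrightarrow> complex_of_real ((cmod (l x))\<^sup>2)"
      using lims by eventually_elim simp
    have bound: "AE x in lborel. cmod (v n x) \<le> indicat_real I x" for n
      using vb by simp
    show "integrable lborel (\<lambda>x. complex_of_real ((cmod (l x))\<^sup>2))"
      by (rule integrable_dominated_convergence[OF meas vm dom lim bound])
    show "(\<lambda>n. integral\<^sup>L lborel (v n)) \<longlonglongrightarrow> (LINT x|lborel. complex_of_real ((cmod (l x))\<^sup>2))"
      by (rule integral_dominated_convergence[OF meas vm dom lim bound])
  qed
  have "(LINT x|lborel. complex_of_real ((cmod (l x))\<^sup>2)) = 0"
    using L2(2) by (simp only: v_int LIMSEQ_const_iff)
  then have "(LINT x|lborel. (cmod (l x))\<^sup>2) = 0"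
    by (simp only: integral_complex_of_real of_real_eq_0_iff)
  moreover have "integrable lborel (\<lambda>x. (cmod (l x))\<^sup>2)"
    using L2(1) by (simp only: complex_of_real_integrable_eq)
  ultimately have "AE x in lborel. (cmod (l x))\<^sup>2 = 0"
    by (subst (asm) integral_nonneg_eq_0_iff_AE) auto
  with lims have lim0: "AE x in lborel. (\<lambda>n. u n x) \<longlonglongrightarrow> 0"
    by eventually_elim auto
  have bound: "AE x in lborel. cmod (u n x) \<le> indicat_real I x" for n
    using ub by simp
  have "(\<lambda>n. integral\<^sup>L lborel (u n)) \<longlonglongrightarrow> (LINT x::real|lborel. 0)"
    by (rule integral_dominated_convergence[OF _ um dom lim0 bound]) simp
  then show ?thesis
    by (simp add: u_int(2) LIMSEQ_const_iff)
qed

lemma cayley_disc_bound: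
  fixes w :: complex
  assumes "Re w > 0"
  shows "w + 1 \<noteq> 0" "cmod ((w - 1) / (w + 1)) \<le> 1"
proof -
  show "w + 1 \<noteq> 0"
    using assms by (auto simp: complex_eq_iff)
  have "(cmod (w - 1))\<^sup>2 \<le> (cmod (w + 1))\<^sup>2"
    using assms by (simp add: cmod_power2) (simp add: power2_eq_square algebra_simps)
  then have "cmod (w - 1) \<le> cmod (w + 1)"
    by (rule power2_le_imp_le) simp
  then show "cmod ((w - 1) / (w + 1)) \<le> 1"
    by (simp add: norm_divide divide_le_eq_1)
qed

text \<open>The Schur functions \<open>s = (F - 1) / (F + 1)\<close> and \<open>t = (G + 1) / (G - 1)\<close> turn the relation
  \<open>F = - cnj G\<close> into \<open>s = cnj t\<close>, and \<open>F 0 = 1\<close> into \<open>s 0 = 0\<close>.\<close>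

lemma reflectionless_pair_value_at_zero:
  fixes F G :: "complex \<Rightarrow> complex"
  assumes F: "F holomorphic_on ball 0 1" "\<And>z. cmod z < 1 \<Longrightarrow> Re (F z) > 0"
    and G: "G holomorphic_on ball 0 1" "\<And>z. cmod z < 1 \<Longrightarrow> Re (G z) < 0"
    and F0: "F 0 = 1"
    and bd: "AE \<zeta> in circle_measure. \<exists>Lp Lm. has_radial_limit F \<zeta> Lp \<and> has_radial_limit G \<zeta> Lm
               \<and> Lp = - cnj Lm"
  shows "G 0 = - 1"
proof -
  let ?c = "\<lambda>w::complex. (w - 1) / (w + 1)"
  have Gm: "- G z + 1 \<noteq> 0" if "cmod z < 1" for z
    using cayley_disc_bound(1)[of "- G z"] G(2)[OF that] by simp
  have "?c (- G 0) = 0"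
  proof (rule conjugate_boundary_values_imp_zero[of "\<lambda>z. ?c (F z)" "\<lambda>z. ?c (- G z)"])
    show "(\<lambda>z. ?c (F z)) holomorphic_on ball 0 1"
      using F cayley_disc_bound(1) by (auto intro!: holomorphic_intros)
    show "(\<lambda>z. ?c (- G z)) holomorphic_on ball 0 1"
      using G(1) Gm by (auto intro!: holomorphic_intros)
    show "cmod (?c (F z)) \<le> 1" "cmod (?c (- G z)) \<le> 1" if "cmod z < 1" for z
      using cayley_disc_bound(2)[of "F z"] cayley_disc_bound(2)[of "- G z"] F(2)[OF that] G(2)[OF that]
      by auto
    show "?c (F 0) = 0"
      by (simp add: F0)
    show "AE \<zeta> in circle_measure. \<exists>L. has_radial_limit (\<lambda>z. ?c (F z)) \<zeta> (cnj L) \<and>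
        has_radial_limit (\<lambda>z. ?c (- G z)) \<zeta> L"
      using bd AE_circle_measure_norm
    proof eventually_elim
      case (elim \<zeta>)
      then obtain Lp Lm where L: "has_radial_limit F \<zeta> Lp" "has_radial_limit G \<zeta> Lm" "Lp = - cnj Lm"
        by auto
      \<comment> \<open>The radial limits lie in the closed half-planes, away from the poles of the Cayley maps.\<close>
      have "eventually (\<lambda>r::real. r \<in> {0<..<1}) (at_left 1)"
        by (rule eventually_at_left_real) simp
      then have "eventually (\<lambda>r. 0 \<le> Re (F (complex_of_real r * \<zeta>))) (at_left 1)"
        by eventually_elim (use elim(2) in \<open>auto intro!: less_imp_le F(2) simp: norm_mult\<close>)
      then have "0 \<le> Re Lp"
        using tendsto_Re[OF L(1)[unfolded has_radial_limit_def]]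
        by (intro tendsto_lowerbound) auto
      then have nz: "Lp + 1 \<noteq> 0" "- Lm + 1 \<noteq> 0"
        using L(3) by (auto simp: complex_eq_iff)
      have "has_radial_limit (\<lambda>z. ?c (F z)) \<zeta> (?c Lp)"
        using L(1) nz(1) unfolding has_radial_limit_def by (intro tendsto_intros)
      moreover have "has_radial_limit (\<lambda>z. ?c (- G z)) \<zeta> (?c (- Lm))"
        using L(2) nz(2) unfolding has_radial_limit_def by (intro tendsto_intros)
      moreover have "?c Lp = cnj (?c (- Lm))"
        by (simp add: L(3))
      ultimately show ?case by metis
    qed
  qed
  with Gm[of 0] have "- G 0 - 1 = 0"
    by simp
  then show ?thesis
    by (metis eq_iff_diff_eq_0 minus_minus)
qed

section \<open>Weyl--Titchmarsh functions of a CMV operator\<close>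

lemma half_lattice_unitary:
  fixes \<alpha> :: "int \<Rightarrow> complex"
  assumes \<alpha>: "\<And>j. cmod (\<alpha> j) \<le> 1" and K: "K = {k..} \<or> K = {..k - 1}"
  shows "\<exists>T'. ell2_unitary K (cmv (\<alpha>(k := 1))) T'"
proof (rule exI, rule cmv_unitary)
  show "cmod ((\<alpha>(k := 1)) j) \<le> 1" for j
    using \<alpha> by simp
  show "rho (\<alpha>(k := 1)) j = 0" if "(j - 1 \<in> K) \<noteq> (j \<in> K)" for j
  proof -
    have "j = k"
      using that K by auto
    then show ?thesis
      by (simp add: rho_def)
  qed
qed

lemma m_plus_caratheodory:
  assumes \<alpha>: "\<And>j. cmod (\<alpha> j) \<le> 1"
  shows "(\<lambda>z. m_plus \<alpha> z k) holomorphic_on ball 0 1"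
    and "cmod z < 1 \<Longrightarrow> Re (m_plus \<alpha> z k) > 0"
    and "m_plus \<alpha> 0 k = 1"
proof -
  obtain T' where "ell2_unitary {k..} (cmv (\<alpha>(k := 1))) T'"
    using half_lattice_unitary[where \<alpha> = \<alpha> and k = k and K = "{k..}", OF \<alpha>] by auto
  then interpret ell2_unitary "{k..}" "cmv (\<alpha>(k := 1))" T' .
  have eq: "m_plus \<alpha> z k = caratheodory {k..} (cmv (\<alpha>(k := 1))) k z" for z
    by (simp add: m_plus_def caratheodory_def cmv_plus_def)
  have k: "k \<in> {k..}"
    by simp
  show "(\<lambda>z. m_plus \<alpha> z k) holomorphic_on ball 0 1"
    unfolding eq by (rule caratheodory_holomorphic[OF k])
  show "cmod z < 1 \<Longrightarrow> Re (m_plus \<alpha> z k) > 0"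
    unfolding eq by (rule Re_caratheodory_pos[OF k])
  show "m_plus \<alpha> 0 k = 1"
    unfolding eq by (rule caratheodory_0[OF k])
qed

lemma m_minus_caratheodory:
  assumes \<alpha>: "\<And>j. cmod (\<alpha> j) \<le> 1"
  shows "(\<lambda>z. m_minus \<alpha> z k) holomorphic_on ball 0 1"
    and "cmod z < 1 \<Longrightarrow> Re (m_minus \<alpha> z k) < 0"
    and "m_minus \<alpha> 0 k = - 1"
proof -
  obtain T' where "ell2_unitary {..k} (cmv (\<alpha>(k + 1 := 1))) T'"
    using half_lattice_unitary[where \<alpha> = \<alpha> and k = "k + 1" and K = "{..k}", OF \<alpha>] by auto
  then interpret ell2_unitary "{..k}" "cmv (\<alpha>(k + 1 := 1))" T' .
  have eq: "m_minus \<alpha> z k = - caratheodory {..k} (cmv (\<alpha>(k + 1 := 1))) k z" for z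
    by (simp add: m_minus_def caratheodory_def cmv_minus_def)
  have k: "k \<in> {..k}"
    by simp
  show "(\<lambda>z. m_minus \<alpha> z k) holomorphic_on ball 0 1"
    unfolding eq by (intro holomorphic_on_minus caratheodory_holomorphic[OF k])
  show "cmod z < 1 \<Longrightarrow> Re (m_minus \<alpha> z k) < 0"
    using Re_caratheodory_pos[OF k] by (simp add: eq)
  show "m_minus \<alpha> 0 k = - 1"
    by (simp add: eq caratheodory_0[OF k])
qed

text \<open>Multiplying by the conjugate of the denominator, the real part of the quotient is
  \<open>(1 - \<bar>a\<bar>\<^sup>2) Re m\<close> divided by a positive number. Conjugated by the
  map \<open>w \<mapsto> (w + 1) / (w - 1)\<close>, which takes the left half-plane to the disc, the transformation is
  the disc automorphism \<open>s \<mapsto> (a - s) / (1 - cnj a * s)\<close>.\<close>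

lemma Re_weyl_transform_neg:
  fixes a m :: complex
  assumes a: "cmod a < 1" and m: "Re m < 0"
  defines "N \<equiv> complex_of_real (Re (1 + a)) + \<i> * complex_of_real (Im (1 - a)) * m"
    and "D \<equiv> \<i> * complex_of_real (Im (1 + a)) + complex_of_real (Re (1 - a)) * m"
  shows "D \<noteq> 0" "Re (N / D) < 0"
proof -
  have "Re a < 1"
    using a complex_Re_le_cmod[of a] by linarith
  then have "Re D < 0"
    using m by (simp add: D_def mult_pos_neg)
  then show D: "D \<noteq> 0"
    by auto
  have "(Re a)\<^sup>2 + (Im a)\<^sup>2 < 1"
    using a by (simp add: cmod_power2[symmetric] power_less_one_iff)
  then have "(1 - (Re a)\<^sup>2 - (Im a)\<^sup>2) * Re m < 0"
    using m by (intro mult_pos_neg) auto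
  also have "(1 - (Re a)\<^sup>2 - (Im a)\<^sup>2) * Re m = Re (N * cnj D)"
    by (simp add: N_def D_def power2_eq_square algebra_simps)
  finally have "Re (N * cnj D) < 0" .
  moreover have "N / D = N * cnj D / complex_of_real ((cmod D)\<^sup>2)"
    using D by (simp only: complex_norm_square) (simp add: field_simps)
  ultimately show "Re (N / D) < 0"
    using D by (simp add: divide_neg_pos)
qed

lemma M_minus_properties:
  assumes \<alpha>: "\<And>j. cmod (\<alpha> j) < 1"
  shows "(\<lambda>z. M_minus \<alpha> z k) holomorphic_on ball 0 1"
    and "cmod z < 1 \<Longrightarrow> Re (M_minus \<alpha> z k) < 0"
    and "M_minus \<alpha> 0 k = (1 + \<alpha> k) / (\<alpha> k - 1)"
proof -
  have le: "cmod (\<alpha> j) \<le> 1" for j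
    using \<alpha>[of j] by simp
  note m = m_minus_caratheodory[where \<alpha> = \<alpha> and k = "k - 1", OF le]
  have "\<i> * complex_of_real (Im (1 + \<alpha> k)) + complex_of_real (Re (1 - \<alpha> k)) * m_minus \<alpha> z (k - 1) \<noteq> 0"
    if "cmod z < 1" for z
    by (rule Re_weyl_transform_neg(1)[OF \<alpha> m(2)[OF that]])
  then show "(\<lambda>z. M_minus \<alpha> z k) holomorphic_on ball 0 1"
    unfolding M_minus_def Let_def by (intro holomorphic_intros m(1)) simp
  show "cmod z < 1 \<Longrightarrow> Re (M_minus \<alpha> z k) < 0"
    unfolding M_minus_def Let_def by (rule Re_weyl_transform_neg(2)[OF \<alpha> m(2)])
  have "complex_of_real (Re (1 + \<alpha> k)) + \<i> * complex_of_real (Im (1 - \<alpha> k)) * - 1 = 1 + \<alpha> k"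
    "\<i> * complex_of_real (Im (1 + \<alpha> k)) + complex_of_real (Re (1 - \<alpha> k)) * - 1 = \<alpha> k - 1"
    by (simp_all add: complex_eq_iff)
  then show "M_minus \<alpha> 0 k = (1 + \<alpha> k) / (\<alpha> k - 1)"
    unfolding M_minus_def Let_def m(3) by (simp only:)
qed

section \<open>Reflectionless coefficients with full spectrum\<close>

text \<open>The circle has no isolated points, and so leaves no room for discrete spectrum.\<close>

lemma essential_spectrum_of_full_circle:
  assumes "spectrum H T = sphere 0 1"
  shows "essential_spectrum H T = sphere 0 1"
proof -
  have conn: "connected (sphere 0 1 :: complex set)"
    by (rule connected_sphere) simp
  have ns: "sphere 0 1 \<noteq> {x}" for x :: complex
  proof
    assume x: "sphere 0 1 = {x}"
    have "1 \<in> {x}" "- 1 \<in> {x}"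
      unfolding x[symmetric] by simp_all
    then have "(1::complex) = - 1"
      by simp
    then show False
      by (simp add: complex_eq_iff)
  qed
  have "\<not> \<zeta> isolated_in (sphere 0 1 :: complex set)" for \<zeta>
    unfolding isolated_in_islimpt_iff using connected_imp_perfect[OF conn _ ns] by blast
  then show ?thesis
    by (auto simp: essential_spectrum_def discrete_spectrum_def assms)
qed

theorem theorem5p1:
  fixes \<alpha> :: "int \<Rightarrow> complex"
  assumes "\<forall>k. \<alpha> k \<in> ball 0 1"
    and "reflectionless \<alpha>"
    and "spectrum (ell2 UNIV) (cmv \<alpha>) = sphere 0 1"
  shows "\<forall>k. \<alpha> k = 0"
proof
  fix k
  have \<alpha>: "cmod (\<alpha> j) < 1" "cmod (\<alpha> j) \<le> 1" for j
    using assms(1) by (auto simp: less_imp_le)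
  have "AE \<zeta> in circle_measure. \<zeta> \<in> sphere 0 1 \<longrightarrow>
      (\<exists>Lp Lm. has_radial_limit (\<lambda>z. M_plus \<alpha> z k) \<zeta> Lp \<and>
               has_radial_limit (\<lambda>z. M_minus \<alpha> z k) \<zeta> Lm \<and> Lp = - cnj Lm)"
    using assms(2) unfolding reflectionless_def essential_spectrum_of_full_circle[OF assms(3)] by blast
  with AE_circle_measure_norm
  have bd: "AE \<zeta> in circle_measure. \<exists>Lp Lm. has_radial_limit (\<lambda>z. M_plus \<alpha> z k) \<zeta> Lp \<and>
      has_radial_limit (\<lambda>z. M_minus \<alpha> z k) \<zeta> Lm \<and> Lp = - cnj Lm"
    by eventually_elim simp
  have "M_minus \<alpha> 0 k = - 1"
    by (rule reflectionless_pair_value_at_zero[OF _ _ _ _ _ bd])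
       (simp_all add: M_plus_def m_plus_caratheodory \<alpha> M_minus_properties)
  moreover have "\<alpha> k - 1 \<noteq> 0"
    using \<alpha>(1)[of k] by auto
  ultimately have "1 + \<alpha> k = - (\<alpha> k - 1)"
    by (simp add: M_minus_properties(3)[where \<alpha> = \<alpha>, OF \<alpha>(1)] divide_eq_eq)
  then have "2 * \<alpha> k = 0"
    by simp
  then show "\<alpha> k = 0"
    by simp
qed

end
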